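(* Let $\mu\neq\nu$ be two probability measures on $\mathbb{R}^d$ (with finite second moments) with optimal transport plan $\pi$. For any $(\tilde\mu,\tilde\nu)\in M(\mu,\nu)$, let $\tilde\pi$ be the associated optimal transport plan between $\tilde\mu$ and $\tilde\nu$. Then for any barycenter $\mu_t=(P_t)_\#\pi$, $t\in[0,1]$, generated by $\mu,\nu$, $$(\mu,\nu)=\operatorname*{arg\,min}_{\substack{(\tilde\mu,\tilde\nu)\in M(\mu,\nu),\\ s\ \text{s.t.}\ (P_s)_\#\tilde\pi=\mu_t}}\ (1-s)\,W_2^2(\tilde\mu,\mu_t)+s\,W_2^2(\tilde\nu,\mu_t).$$ That is, among all pairs of measures that contain the McCann interpolation between $\mu$ and $\nu$, the objective is minimized by $(\mu,\nu)$, and this pair is the unique solution.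
   Context: For probability measures $\mu,\nu$ on $\mathbb{R}^d$, $\Pi(\mu,\nu)$ is the set of joint distributions on $\mathbb{R}^d\times\mathbb{R}^d$ with marginals $\mu$ and $\nu$, and $W_2^2(\mu,\nu)=\min_{\gamma\in\Pi(\mu,\nu)}\int\|\mathbf{x}-\mathbf{y}\|_2^2\,d\gamma(\mathbf{x},\mathbf{y})$; a minimizer is called an optimal transport plan. For $t\in[0,1]$, $P_t(\mathbf{x},\mathbf{y})=(1-t)\mathbf{x}+t\mathbf{y}$, and $(P_t)_\#$ denotes pushforward by $P_t$. If $\pi$ is an optimal transport plan between $\mu$ and $\nu$, the McCann interpolation between $\mu$ and $\nu$ is the family $\{(P_t)_\#\pi\}_{t\in[0,1]}$; $(P_t)_\#\pi$ coincides with the Wasserstein-2 barycenter of $\mu,\nu$ with weights $(1-t,t)$, where the barycenter of measures $\mathcal{D}_1,\dots,\mathcal{D}_m$ with weights $\lambda_1,\dots,\lambda_m\ge 0$ summing to $1$ is the minimizer over probability measures $\eta$ on $\mathbb{R}^d$ of $\sum_{j}\lambda_j W_2^2(\mathcal{D}_j,\eta)$. Containment: let $\mu,\nu$ be probability measures on $\mathbb{R}^d$ with optimal transport plan $\pi$ and let $\tilde\mu,\tilde\nu$ be probability measures on $\mathbb{R}^d$ with optimal transport plan $\tilde\pi$. The measures $\tilde\mu,\tilde\nu$ are said to contain the McCann interpolation $\{(P_t)_\#\pi\}_{t\in[0,1]}$ between $\mu$ and $\nu$ if there exists an interval $[a,b]\subset[0,1]$ such that for every $t\in[0,1]$ there exists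 $s\in[a,b]$ with $(P_s)_\#\tilde\pi=(P_t)_\#\pi$. The set of all pairs $(\tilde\mu,\tilde\nu)$ that contain the McCann interpolation between $\mu$ and $\nu$ is denoted $M(\mu,\nu)$.
   Formalization: Uniqueness is proved only up to order of the pair (the swapped pair (ν,μ) with s=1−t always ties) and only for 0<t<1 (at t=0, μ=δ_0, ν=δ_1, the pair (δ_0,δ_2) also attains the minimum 0); minimality of (μ,ν) is proved for all t in [0,1]. *)

theory Defs
  imports "HOL-Probability.Probability"
begin

abbreviation borel_probs :: "('a::topological_space) measure set" where
  "borel_probs \<equiv> space (prob_algebra borel)"

definition finite_second_moment :: "('a::real_normed_vector) measure \<Rightarrow> bool" where
  "finite_second_moment \<mu> \<longleftrightarrow> (\<integral>\<^sup>+x. ennreal ((norm x)\<^sup>2) \<partial>\<mu>) < \<infinity>"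

definition couplings ::
    "('a::euclidean_space) measure \<Rightarrow> 'a measure \<Rightarrow> ('a \<times> 'a) measure set" where
  "couplings \<mu> \<nu> = {\<gamma> \<in> borel_probs. distr \<gamma> borel fst = \<mu> \<and> distr \<gamma> borel snd = \<nu>}"

definition transport_cost :: "(('a::euclidean_space) \<times> 'a) measure \<Rightarrow> ennreal" where
  "transport_cost \<gamma> = (\<integral>\<^sup>+(x, y). ennreal ((norm (x - y))\<^sup>2) \<partial>\<gamma>)"

text \<open>The squared distance is extended-valued, since the measures compared in the
  minimisation problem below are not required to have finite second moments.\<close>

definition W2_sq :: "('a::euclidean_space) measure \<Rightarrow> 'a measure \<Rightarrow> ennreal" where
  "W2_sq \<mu> \<nu> = (INF \<gamma>\<in>couplings \<mu> \<nu>. transport_cost \<gamma>)"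

definition optimal_plan ::
    "('a::euclidean_space) measure \<Rightarrow> 'a measure \<Rightarrow> ('a \<times> 'a) measure \<Rightarrow> bool" where
  "optimal_plan \<mu> \<nu> \<pi> \<longleftrightarrow> is_arg_min transport_cost (\<lambda>\<gamma>. \<gamma> \<in> couplings \<mu> \<nu>) \<pi>"

definition interp :: "real \<Rightarrow> ('a::euclidean_space) \<times> 'a \<Rightarrow> 'a" where
  "interp t = (\<lambda>(x, y). (1 - t) *\<^sub>R x + t *\<^sub>R y)"

definition mccann :: "(('a::euclidean_space) \<times> 'a) measure \<Rightarrow> real \<Rightarrow> 'a measure" where
  "mccann \<pi> t = distr \<pi> borel (interp t)"

definition contains_mccann ::
    "(('a::euclidean_space) \<times> 'a) measure \<Rightarrow> ('a \<times> 'a) measure \<Rightarrow> bool" where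
  "contains_mccann \<pi>' \<pi> \<longleftrightarrow>
     (\<exists>a b. 0 \<le> a \<and> a \<le> b \<and> b \<le> 1 \<and>
        (\<forall>t\<in>{0..1}. \<exists>s\<in>{a..b}. mccann \<pi>' s = mccann \<pi> t))"

text \<open>Optimal plans need not be unique. The plans associated with a pair are all those
  optimal plans whose interpolation contains that of \<open>\<pi>\<close>; accordingly the
  set of containing pairs depends on the chosen plan \<open>\<pi>\<close> and not only on its marginals.\<close>

definition associated_plans ::
    "(('a::euclidean_space) \<times> 'a) measure \<Rightarrow> 'a measure \<times> 'a measure \<Rightarrow> ('a \<times> 'a) measure set" where
  "associated_plans \<pi> = (\<lambda>(\<mu>', \<nu>'). {\<pi>'. optimal_plan \<mu>' \<nu>' \<pi>' \<and> contains_mccann \<pi>' \<pi>})"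

definition containing_pairs ::
    "(('a::euclidean_space) \<times> 'a) measure \<Rightarrow> ('a measure \<times> 'a measure) set" where
  "containing_pairs \<pi> = {p \<in> borel_probs \<times> borel_probs. associated_plans \<pi> p \<noteq> {}}"

definition feasible ::
    "(('a::euclidean_space) \<times> 'a) measure \<Rightarrow> real \<Rightarrow> (('a measure \<times> 'a measure) \<times> real) set" where
  "feasible \<pi> t = {(p, s). p \<in> containing_pairs \<pi> \<and> s \<in> {0..1} \<and>
     (\<exists>\<pi>'\<in>associated_plans \<pi> p. mccann \<pi>' s = mccann \<pi> t)}"

definition objective ::
    "('a::euclidean_space) measure \<Rightarrow> ('a measure \<times> 'a measure) \<times> real \<Rightarrow> ennreal" where
  "objective \<eta> = (\<lambda>((\<mu>', \<nu>'), s). ennreal (1 - s) * W2_sq \<mu>' \<eta> + ennreal s * W2_sq \<nu>' \<eta>)"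

text \<open>Containment does not fix an orientation: reversing a containing plan gives a containing
  plan for the swapped pair, feasible at \<open>1 - s\<close> with the same objective value. Minimising
  pairs are therefore determined at best up to order. For \<open>t\<close> equal to 0 or 1 they are not
  determined at all in general: any containing pair that starts at \<open>\<mu>\<close>, for instance, has
  objective value 0 at \<open>t = s = 0\<close>.\<close>

definition argmin_pairs ::
    "(('a::euclidean_space) \<times> 'a) measure \<Rightarrow> real \<Rightarrow> ('a measure \<times> 'a measure) set" where
  "argmin_pairs \<pi> t =
     {p. \<exists>s. is_arg_min (objective (mccann \<pi> t)) (\<lambda>q. q \<in> feasible \<pi> t) (p, s)}"

end

theory Submission
  imports Defs
begin

text \<open>Along an optimal plan of finite cost \<open>d\<^sup>2\<close> the interpolation is a geodesic,
  \<open>W\<^sub>2(\<mu>\<^sub>a, \<mu>\<^sub>b) = \<bar>a - b\<bar> d\<close>, by the triangle inequality for \<open>W\<^sub>2\<close>. Hence a pair feasible at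
  \<open>s\<close>, with plan of cost \<open>d'\<^sup>2\<close>, has objective \<open>s (1 - s) d'\<^sup>2\<close>. If its interpolation passes
  through \<open>\<mu>\<close> and \<open>\<nu>\<close> at \<open>u\<close> and \<open>v\<close>, comparing distances puts \<open>s\<close> between \<open>u\<close> and \<open>v\<close> and gives
  \<open>t (1 - t) d\<^sup>2 = \<bar>u - s\<bar> \<bar>v - s\<bar> d'\<^sup>2 \<le> s (1 - s) d'\<^sup>2\<close>; for \<open>0 < t < 1\<close> equality forces
  \<open>{u, v} = {0, 1}\<close>. The cost of a containing plan is finite because two distinct points of its
  interpolation, \<open>\<mu>\<close> and \<open>\<nu>\<close>, have finite second moments.\<close>

section \<open>Measurability, couplings induced by maps, and reversal of plans\<close>

lemma interp_measurable [measurable]: "interp t \<in> borel_measurable borel"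
  unfolding interp_def case_prod_beta
  by (intro borel_measurable_continuous_onI continuous_intros)

lemma fst_borel [measurable]:
  "(fst :: 'a::topological_space \<times> 'b::topological_space \<Rightarrow> 'a) \<in> borel_measurable borel"
  by (intro borel_measurable_continuous_onI continuous_intros)

lemma snd_borel [measurable]:
  "(snd :: 'a::topological_space \<times> 'b::topological_space \<Rightarrow> 'b) \<in> borel_measurable borel"
  by (intro borel_measurable_continuous_onI continuous_intros)

lemma borel_probs_iff: "M \<in> borel_probs \<longleftrightarrow> prob_space M \<and> sets M = sets borel"
  by (auto simp: space_prob_algebra)

lemma distr_borel_probs:
  assumes "prob_space M" "f \<in> borel_measurable M"
  shows "distr M borel f \<in> borel_probs"
  using assms by (auto simp: borel_probs_iff intro: prob_space.prob_space_distr)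

lemma coupling_of_maps:
  fixes f g :: "'b \<Rightarrow> 'a::euclidean_space"
  assumes "prob_space M" and [measurable]: "f \<in> borel_measurable M" "g \<in> borel_measurable M"
  shows "distr M borel (\<lambda>x. (f x, g x)) \<in> couplings (distr M borel f) (distr M borel g)"
  unfolding couplings_def
  by (auto intro!: distr_borel_probs assms simp: distr_distr comp_def)

lemma transport_cost_of_maps:
  fixes f g :: "'b \<Rightarrow> 'a::euclidean_space"
  assumes [measurable]: "f \<in> borel_measurable M" "g \<in> borel_measurable M"
  shows "transport_cost (distr M borel (\<lambda>x. (f x, g x))) = (\<integral>\<^sup>+x. ennreal ((norm (f x - g x))\<^sup>2) \<partial>M)"
  unfolding transport_cost_def case_prod_beta
  by (subst nn_integral_distr) auto

text \<open>The joint law of two maps on a common probability space couples their laws. Upper bounds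
  on \<open>W2_sq\<close> are obtained below by exhibiting such maps.\<close>

lemma W2_sq_le_of_maps:
  fixes f g :: "'b \<Rightarrow> 'a::euclidean_space"
  assumes "prob_space M" "f \<in> borel_measurable M" "g \<in> borel_measurable M"
  shows "W2_sq (distr M borel f) (distr M borel g) \<le> (\<integral>\<^sup>+x. ennreal ((norm (f x - g x))\<^sup>2) \<partial>M)"
  unfolding W2_sq_def transport_cost_of_maps[OF assms(2,3), symmetric]
  by (intro INF_lower coupling_of_maps assms)

lemma couplingsD:
  assumes "\<gamma> \<in> couplings \<mu> \<nu>"
  shows "prob_space \<gamma>" "sets \<gamma> = sets borel" "distr \<gamma> borel fst = \<mu>" "distr \<gamma> borel snd = \<nu>"
  using assms by (auto simp: couplings_def borel_probs_iff)

text \<open>Reversal serves twice: it makes \<open>W2_sq\<close> symmetric, and it supplies the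
  second minimiser \<open>(\<nu>, \<mu>)\<close>.\<close>

definition swap_plan :: "('a::euclidean_space \<times> 'a) measure \<Rightarrow> ('a \<times> 'a) measure" where
  "swap_plan \<gamma> = distr \<gamma> borel (\<lambda>p. (snd p, fst p))"

lemma swap_plan_coupling:
  assumes "\<gamma> \<in> couplings \<mu> \<nu>"
  shows "swap_plan \<gamma> \<in> couplings \<nu> \<mu>"
  using coupling_of_maps[of \<gamma> snd fst] couplingsD[OF assms]
  by (simp add: swap_plan_def measurable_cong_sets[of \<gamma> borel])

lemma transport_cost_swap_plan:
  assumes "\<gamma> \<in> couplings \<mu> \<nu>"
  shows "transport_cost (swap_plan \<gamma>) = transport_cost \<gamma>"
  using transport_cost_of_maps[of snd \<gamma> fst] couplingsD[OF assms]
  by (simp add: swap_plan_def measurable_cong_sets[of \<gamma> borel] norm_minus_commute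
      transport_cost_def[of \<gamma>] case_prod_beta')

lemma W2_sq_commute: "W2_sq \<mu> \<nu> = W2_sq \<nu> \<mu>"
proof -
  have "W2_sq \<nu> \<mu> \<le> W2_sq \<mu> \<nu>" for \<mu> \<nu> :: "'a measure"
    unfolding W2_sq_def
    by (intro INF_mono) (metis swap_plan_coupling transport_cost_swap_plan order_refl)
  then show ?thesis by (intro antisym)
qed

lemma optimal_planD:
  assumes "optimal_plan \<mu> \<nu> \<pi>"
  shows "\<pi> \<in> couplings \<mu> \<nu>" "W2_sq \<mu> \<nu> = transport_cost \<pi>"
  using assms unfolding optimal_plan_def is_arg_min_linorder W2_sq_def
  by (auto intro!: antisym INF_lower INF_greatest)

lemma optimal_plan_swap:
  assumes "optimal_plan \<mu> \<nu> \<pi>"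
  shows "optimal_plan \<nu> \<mu> (swap_plan \<pi>)"
  using assms unfolding optimal_plan_def is_arg_min_linorder
  by (metis swap_plan_coupling transport_cost_swap_plan)

lemma mccann_ends:
  assumes "\<pi> \<in> couplings \<mu> \<nu>"
  shows "mccann \<pi> 0 = \<mu>" "mccann \<pi> 1 = \<nu>"
  using couplingsD[OF assms] by (auto simp: mccann_def interp_def fst_def[abs_def] snd_def[abs_def])

lemma mccann_swap_plan:
  assumes "sets \<pi> = sets borel"
  shows "mccann (swap_plan \<pi>) s = mccann \<pi> (1 - s)"
  using assms unfolding mccann_def swap_plan_def
  by (subst distr_distr)
    (auto simp: measurable_cong_sets[of \<pi> borel] interp_def comp_def case_prod_beta' add.commute)

section \<open>Approximate gluing and the triangle inequality\<close>

text \<open>Label each point by the first member of a countable dense sequence within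
  \<open>e / 2\<close> of it; points sharing a label are then less than \<open>e\<close> apart. With
  countably many labels, conditioning on a point can be replaced by conditioning on an
  event.\<close>

lemma countable_small_cells:
  fixes e :: real
  assumes "e > 0"
  obtains c :: "'a::euclidean_space \<Rightarrow> nat" where
    "c \<in> measurable borel (count_space UNIV)" "\<And>x y. c x = c y \<Longrightarrow> dist x y < e"
proof -
  obtain D :: "'a set" where D: "countable D" "\<And>X. open X \<Longrightarrow> X \<noteq> {} \<Longrightarrow> \<exists>d\<in>D. d \<in> X"
    using countable_dense_exists by blast
  have "D \<noteq> {}" using D(2)[of UNIV] by auto
  define d where "d = from_nat_into D"
  have ex: "\<exists>n. dist x (d n) < e / 2" for x
  proof -
    obtain y where "y \<in> D" "y \<in> ball x (e/2)"
      using D(2)[of "ball x (e/2)"] assms by auto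
    then show ?thesis
      using from_nat_into_surj[OF D(1)] unfolding d_def by fastforce
  qed
  define c where "c = (\<lambda>x. LEAST n. dist x (d n) < e / 2)"
  have c: "dist x (d (c x)) < e / 2" for x
    unfolding c_def by (rule LeastI_ex[OF ex])
  show thesis
  proof
    show "c \<in> measurable borel (count_space UNIV)"
      unfolding c_def by measurable
    show "dist x y < e" if "c x = c y" for x y
      using c[of x] c[of y] that by (metis dist_triangle_half_l)
  qed
qed

text \<open>There are only countably many fibres, so the union of the null ones is null. This
  permits division by the mass of the cell containing a random point.\<close>

lemma AE_nonnull_fibre:
  fixes f :: "'b \<Rightarrow> 'c::countable"
  assumes [measurable]: "f \<in> measurable M (count_space UNIV)"
  shows "AE x in M. emeasure M {y \<in> space M. f y = f x} \<noteq> 0"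
proof -
  have "AE x in M. \<forall>n. f x = n \<longrightarrow> emeasure M {y \<in> space M. f y = n} \<noteq> 0"
    unfolding AE_all_countable
  proof
    fix n
    show "AE x in M. f x = n \<longrightarrow> emeasure M {y \<in> space M. f y = n} \<noteq> 0"
    proof (cases "emeasure M {y \<in> space M. f y = n} = 0")
      case True
      then have "{y \<in> space M. f y = n} \<in> null_sets M"
        by (auto simp: null_sets_def)
      then show ?thesis by (rule AE_I') auto
    qed simp
  qed
  then show ?thesis by simp
qed

text \<open>Instead of a disintegration, the two plans are made conditionally independent given only
  the cell of the middle point. This keeps the two plans as exact marginals, and moves the middle
  point by less than the diameter of a cell.\<close>

lemma approximate_gluing:
  fixes \<gamma>\<^sub>1 \<gamma>\<^sub>2 :: "('a::euclidean_space \<times> 'a) measure"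
  assumes g1: "\<gamma>\<^sub>1 \<in> couplings \<mu> \<eta>" and g2: "\<gamma>\<^sub>2 \<in> couplings \<eta> \<nu>" and "e > 0"
  obtains \<rho> where "sets \<rho> = sets (borel :: (('a \<times> 'a) \<times> ('a \<times> 'a)) measure)"
    "distr \<rho> borel fst = \<gamma>\<^sub>1" "distr \<rho> borel snd = \<gamma>\<^sub>2"
    "AE p in \<rho>. dist (snd (fst p)) (fst (snd p)) < e"
proof -
  note c1 = couplingsD[OF g1] and c2 = couplingsD[OF g2]
  interpret P1: prob_space \<gamma>\<^sub>1 by (rule c1)
  interpret P2: prob_space \<gamma>\<^sub>2 by (rule c2)
  interpret P12: pair_prob_space \<gamma>\<^sub>1 \<gamma>\<^sub>2 ..
  note sets_eq [measurable_cong] = c1(2) c2(2)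
  have sets_pair: "sets (\<gamma>\<^sub>1 \<Otimes>\<^sub>M \<gamma>\<^sub>2) = sets borel"
    unfolding sets_pair_measure_cong[OF c1(2) c2(2)] by (simp only: borel_prod)
  obtain c :: "'a \<Rightarrow> nat" where [measurable]: "c \<in> measurable borel (count_space UNIV)"
    and c: "\<And>x y. c x = c y \<Longrightarrow> dist x y < e"
    using countable_small_cells[OF \<open>e > 0\<close>] by metis
  \<comment> \<open>Both plans have \<open>\<eta>\<close> as their middle marginal, so a cell has
    the same mass under either of them, and one normalisation serves both marginals of the glued
    measure.\<close>
  define m where "m n = emeasure \<eta> {z. c z = n}" for n
  have m1: "m n = emeasure \<gamma>\<^sub>1 {p. c (snd p) = n}" for n
    unfolding m_def c1(4)[symmetric] using c1(2) sets_eq_imp_space_eq[OF c1(2)]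
    by (subst emeasure_distr) (auto simp: vimage_def)
  have m2: "m n = emeasure \<gamma>\<^sub>2 {q. c (fst q) = n}" for n
    unfolding m_def c2(3)[symmetric] using c2(2) sets_eq_imp_space_eq[OF c2(2)]
    by (subst emeasure_distr) (auto simp: vimage_def)
  have m_fin: "m n \<noteq> \<infinity>" for n
    unfolding m1 by simp
  \<comment> \<open>Drawing cell \<open>n\<close> with probability \<open>m n\<close> and then both
    plans independently, each conditioned on that cell, has density \<open>m n / (m n * m n)\<close>
    with respect to the product measure. On a null cell \<open>inverse\<close> is infinite;
    \<open>ae1\<close> and \<open>ae2\<close> show that such cells are almost never met.\<close>
  define f :: "('a \<times> 'a) \<times> ('a \<times> 'a) \<Rightarrow> ennreal" where
    "f = (\<lambda>(p, q). if c (snd p) = c (fst q) then inverse (m (c (snd p))) else 0)"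
  have u: "(\<lambda>x. c (snd (fst x))) \<in> measurable (borel :: (('a \<times> 'a) \<times> ('a \<times> 'a)) measure) (count_space UNIV)"
    and v: "(\<lambda>x. c (fst (snd x))) \<in> measurable (borel :: (('a \<times> 'a) \<times> ('a \<times> 'a)) measure) (count_space UNIV)"
    by (intro measurable_compose[OF _ \<open>c \<in> _\<close>] measurable_compose[OF fst_borel snd_borel]
        measurable_compose[OF snd_borel fst_borel])+
  have "f \<in> borel_measurable borel"
    unfolding f_def case_prod_beta'
    by (rule measurable_compose_countable[OF measurable_compose[OF v] u,
          of "\<lambda>n k. if n = k then inverse (m n) else 0"]) simp
  then have f_meas [measurable]: "f \<in> borel_measurable (\<gamma>\<^sub>1 \<Otimes>\<^sub>M \<gamma>\<^sub>2)"
    by (simp add: measurable_cong_sets[OF sets_pair refl])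
  have ae1: "AE p in \<gamma>\<^sub>1. m (c (snd p)) \<noteq> 0"
    unfolding m1 using AE_nonnull_fibre[of "\<lambda>p. c (snd p)" \<gamma>\<^sub>1] sets_eq_imp_space_eq[OF c1(2)] by simp
  have ae2: "AE q in \<gamma>\<^sub>2. m (c (fst q)) \<noteq> 0"
    unfolding m2 using AE_nonnull_fibre[of "\<lambda>q. c (fst q)" \<gamma>\<^sub>2] sets_eq_imp_space_eq[OF c2(2)] by simp
  have inv: "inverse (m n) * m n = 1" if "m n \<noteq> 0" for n
    using that m_fin[of n]
    by (metis divide_ennreal_def ennreal_divide_self infinity_ennreal_def mult.commute
        top.not_eq_extremum)
  have f1: "(\<lambda>q. f (p, q)) \<in> borel_measurable \<gamma>\<^sub>2" for p
    using measurable_compose[OF measurable_Pair1' f_meas] sets_eq_imp_space_eq[OF c1(2)] by simp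
  have f2: "(\<lambda>p. f (p, q)) \<in> borel_measurable \<gamma>\<^sub>1" for q
    using measurable_compose[OF measurable_Pair2' f_meas] sets_eq_imp_space_eq[OF c2(2)] by simp
  \<comment> \<open>The product is not simplified to 1, since it is 0 on null cells; it equals 1
    only almost everywhere.\<close>
  have int2: "(\<integral>\<^sup>+q. f (p, q) \<partial>\<gamma>\<^sub>2) = inverse (m (c (snd p))) * m (c (snd p))" for p
  proof -
    have "(\<integral>\<^sup>+q. f (p, q) \<partial>\<gamma>\<^sub>2) =
        (\<integral>\<^sup>+q. inverse (m (c (snd p))) * indicator {q. c (fst q) = c (snd p)} q \<partial>\<gamma>\<^sub>2)"
      by (intro nn_integral_cong) (auto simp: f_def)
    then show ?thesis by (simp add: nn_integral_cmult_indicator sets_eq m2)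
  qed
  have int1: "(\<integral>\<^sup>+p. f (p, q) \<partial>\<gamma>\<^sub>1) = inverse (m (c (fst q))) * m (c (fst q))" for q
  proof -
    have "(\<integral>\<^sup>+p. f (p, q) \<partial>\<gamma>\<^sub>1) =
        (\<integral>\<^sup>+p. inverse (m (c (fst q))) * indicator {p. c (snd p) = c (fst q)} p \<partial>\<gamma>\<^sub>1)"
      by (intro nn_integral_cong) (auto simp: f_def)
    then show ?thesis by (simp add: nn_integral_cmult_indicator sets_eq m1)
  qed
  define \<rho> where "\<rho> = density (\<gamma>\<^sub>1 \<Otimes>\<^sub>M \<gamma>\<^sub>2) f"
  have sets_\<rho>: "sets \<rho> = sets borel"
    by (simp add: \<rho>_def sets_pair)
  have space_\<rho>: "space \<rho> = UNIV"
    using sets_eq_imp_space_eq[OF sets_\<rho>] by simp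
  show thesis
  proof
    show "sets \<rho> = sets borel" by (rule sets_\<rho>)
    show "distr \<rho> borel fst = \<gamma>\<^sub>1"
    proof (rule measure_eqI)
      fix A assume "A \<in> sets (distr \<rho> borel fst)"
      then have [measurable]: "A \<in> sets borel" by simp
      have "emeasure (distr \<rho> borel fst) A = emeasure \<rho> (fst -` A)"
        by (subst emeasure_distr) (auto simp: measurable_cong_sets[OF sets_\<rho> refl] space_\<rho>)
      also have "\<dots> = (\<integral>\<^sup>+x. f x * indicator (fst -` A) x \<partial>(\<gamma>\<^sub>1 \<Otimes>\<^sub>M \<gamma>\<^sub>2))"
        unfolding \<rho>_def
        by (rule emeasure_density) (use measurable_sets[OF fst_borel, of A] in \<open>auto simp: sets_pair\<close>)
      also have "\<dots> = (\<integral>\<^sup>+p. \<integral>\<^sup>+q. f (p, q) * indicator A p \<partial>\<gamma>\<^sub>2 \<partial>\<gamma>\<^sub>1)"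
        by (subst P2.nn_integral_fst[symmetric])
          (use measurable_sets[OF fst_borel, of A] in \<open>auto simp: sets_pair indicator_def intro!: nn_integral_cong\<close>)
      also have "\<dots> = (\<integral>\<^sup>+p. inverse (m (c (snd p))) * m (c (snd p)) * indicator A p \<partial>\<gamma>\<^sub>1)"
        by (subst nn_integral_multc) (auto simp: int2 f1)
      also have "\<dots> = (\<integral>\<^sup>+p. indicator A p \<partial>\<gamma>\<^sub>1)"
        by (rule nn_integral_cong_AE) (use ae1 in eventually_elim, simp add: inv)
      finally show "emeasure (distr \<rho> borel fst) A = emeasure \<gamma>\<^sub>1 A"
        by (simp add: sets_eq)
    qed (simp add: sets_eq)
    show "distr \<rho> borel snd = \<gamma>\<^sub>2"
    proof (rule measure_eqI)
      fix A assume "A \<in> sets (distr \<rho> borel snd)"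
      then have [measurable]: "A \<in> sets borel" by simp
      have "emeasure (distr \<rho> borel snd) A = emeasure \<rho> (snd -` A)"
        by (subst emeasure_distr) (auto simp: measurable_cong_sets[OF sets_\<rho> refl] space_\<rho>)
      also have "\<dots> = (\<integral>\<^sup>+x. f x * indicator (snd -` A) x \<partial>(\<gamma>\<^sub>1 \<Otimes>\<^sub>M \<gamma>\<^sub>2))"
        unfolding \<rho>_def
        by (rule emeasure_density) (use measurable_sets[OF snd_borel, of A] in \<open>auto simp: sets_pair\<close>)
      also have "\<dots> = (\<integral>\<^sup>+q. \<integral>\<^sup>+p. f (p, q) * indicator A q \<partial>\<gamma>\<^sub>1 \<partial>\<gamma>\<^sub>2)"
        by (subst P12.nn_integral_snd[symmetric])
          (use measurable_sets[OF snd_borel, of A] in \<open>auto simp: sets_pair indicator_def intro!: nn_integral_cong\<close>)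
      also have "\<dots> = (\<integral>\<^sup>+q. inverse (m (c (fst q))) * m (c (fst q)) * indicator A q \<partial>\<gamma>\<^sub>2)"
        by (subst nn_integral_multc) (auto simp: int1 f2)
      also have "\<dots> = (\<integral>\<^sup>+q. indicator A q \<partial>\<gamma>\<^sub>2)"
        by (rule nn_integral_cong_AE) (use ae2 in eventually_elim, simp add: inv)
      finally show "emeasure (distr \<rho> borel snd) A = emeasure \<gamma>\<^sub>2 A"
        by (simp add: sets_eq)
    qed (simp add: sets_eq)
    show "AE p in \<rho>. dist (snd (fst p)) (fst (snd p)) < e"
      unfolding \<rho>_def
      by (subst AE_density[OF f_meas]) (auto simp: f_def split: if_splits dest: c intro!: AE_I2)
  qed
qed

text \<open>Cauchy--Schwarz in the form that turns bounds on \<open>u\<^sup>2\<close> and \<open>v\<^sup>2\<close> in the mean into Minkowski's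
  inequality.\<close>

lemma square_sum_le_weighted:
  fixes u v e r q :: real
  assumes "r > 0" "q > 0" "e > 0"
  shows "(u + v + e)\<^sup>2 \<le> (r + q + e) * (u\<^sup>2 / r + v\<^sup>2 / q + e)"
proof -
  \<comment> \<open>Lagrange's identity for the vectors \<open>(sqrt r, sqrt q, sqrt e)\<close> and
    \<open>(u / sqrt r, v / sqrt q, sqrt e)\<close>.\<close>
  have "(r + q + e) * (u\<^sup>2 / r + v\<^sup>2 / q + e) - (u + v + e)\<^sup>2 =
      (q * u - r * v)\<^sup>2 / (r * q) + e * (u - r)\<^sup>2 / r + e * (v - q)\<^sup>2 / q"
    using assms by (simp add: field_simps power2_eq_square)
  also have "\<dots> \<ge> 0"
    using assms by simp
  finally show ?thesis by simp
qed

text \<open>On the glued space the outer points are at most \<open>u + v + e\<close> apart, where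
  \<open>e\<close> bounds the gap between the two copies of the middle point. Weighting by
  \<open>r\<close>, \<open>q\<close>, \<open>e\<close> makes the bound linear in the squared
  lengths, so the costs can be inserted after integration:
  \<open>r\<^sup>2 / r + q\<^sup>2 / q + e\<close> is again \<open>r + q + e\<close>.\<close>

lemma W2_sq_approximate_triangle:
  fixes \<gamma>\<^sub>1 \<gamma>\<^sub>2 :: "('a::euclidean_space \<times> 'a) measure"
  assumes g1: "\<gamma>\<^sub>1 \<in> couplings \<mu> \<eta>" and g2: "\<gamma>\<^sub>2 \<in> couplings \<eta> \<nu>"
    and pos: "r > 0" "q > 0" "e > 0"
    and cost: "transport_cost \<gamma>\<^sub>1 \<le> ennreal (r\<^sup>2)" "transport_cost \<gamma>\<^sub>2 \<le> ennreal (q\<^sup>2)"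
  shows "W2_sq \<mu> \<nu> \<le> ennreal ((r + q + e)\<^sup>2)"
proof -
  note c1 = couplingsD[OF g1] and c2 = couplingsD[OF g2]
  obtain \<rho> where \<rho>: "sets \<rho> = sets (borel :: (('a \<times> 'a) \<times> ('a \<times> 'a)) measure)"
    "distr \<rho> borel fst = \<gamma>\<^sub>1" "distr \<rho> borel snd = \<gamma>\<^sub>2"
    "AE p in \<rho>. dist (snd (fst p)) (fst (snd p)) < e"
    by (rule approximate_gluing[OF g1 g2 \<open>e > 0\<close>])
  note [measurable_cong] = \<rho>(1)
  have "prob_space (distr \<rho> borel fst)"
    using c1(1) \<rho>(2) by simp
  then interpret prob_space \<rho>
    by (rule prob_space_distrD[rotated]) measurable
  define u where "u p = norm (fst (fst p) - snd (fst p))" for p :: "('a \<times> 'a) \<times> ('a \<times> 'a)"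
  define v where "v p = norm (fst (snd p) - snd (snd p))" for p :: "('a \<times> 'a) \<times> ('a \<times> 'a)"
  have [measurable]: "u \<in> borel_measurable borel" "v \<in> borel_measurable borel"
    unfolding u_def v_def by measurable
  have \<mu>: "\<mu> = distr \<rho> borel (\<lambda>p. fst (fst p))"
    unfolding c1(3)[symmetric] \<rho>(2)[symmetric] by (subst distr_distr) (auto simp: comp_def)
  have \<nu>: "\<nu> = distr \<rho> borel (\<lambda>p. snd (snd p))"
    unfolding c2(4)[symmetric] \<rho>(3)[symmetric] by (subst distr_distr) (auto simp: comp_def)
  have Iu: "(\<integral>\<^sup>+p. ennreal ((u p)\<^sup>2) \<partial>\<rho>) \<le> ennreal (r\<^sup>2)"
    using cost(1) unfolding \<rho>(2)[symmetric] transport_cost_def case_prod_beta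
    by (subst (asm) nn_integral_distr) (auto simp: u_def)
  have Iv: "(\<integral>\<^sup>+p. ennreal ((v p)\<^sup>2) \<partial>\<rho>) \<le> ennreal (q\<^sup>2)"
    using cost(2) unfolding \<rho>(3)[symmetric] transport_cost_def case_prod_beta
    by (subst (asm) nn_integral_distr) (auto simp: v_def)
  have "W2_sq \<mu> \<nu> \<le> (\<integral>\<^sup>+p. ennreal ((norm (fst (fst p) - snd (snd p)))\<^sup>2) \<partial>\<rho>)"
    unfolding \<mu> \<nu> by (rule W2_sq_le_of_maps) (auto intro: prob_space_axioms)
  also have "\<dots> \<le> (\<integral>\<^sup>+p. ennreal (r + q + e) *
      (ennreal (1 / r) * ennreal ((u p)\<^sup>2) + ennreal (1 / q) * ennreal ((v p)\<^sup>2) + ennreal e) \<partial>\<rho>)"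
  proof (rule nn_integral_mono_AE, use \<rho>(4) in eventually_elim)
    case (elim p)
    have "norm (fst (fst p) - snd (snd p)) \<le> u p + v p + e"
      using elim unfolding u_def v_def dist_norm by norm
    then have "(norm (fst (fst p) - snd (snd p)))\<^sup>2 \<le> (u p + v p + e)\<^sup>2"
      by (rule power_mono) simp
    also have "\<dots> \<le> (r + q + e) * ((u p)\<^sup>2 / r + (v p)\<^sup>2 / q + e)"
      by (rule square_sum_le_weighted) (use pos in auto)
    finally show ?case
      using pos by (simp add: ennreal_mult[symmetric] ennreal_plus[symmetric] ennreal_leI
          del: ennreal_plus)
  qed
  also have "\<dots> = ennreal (r + q + e) * (ennreal (1 / r) * (\<integral>\<^sup>+p. ennreal ((u p)\<^sup>2) \<partial>\<rho>)
      + ennreal (1 / q) * (\<integral>\<^sup>+p. ennreal ((v p)\<^sup>2) \<partial>\<rho>) + ennreal e)"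
    by (simp add: nn_integral_cmult nn_integral_add emeasure_space_1)
  also have "\<dots> \<le> ennreal (r + q + e) * (ennreal (1 / r) * ennreal (r\<^sup>2)
      + ennreal (1 / q) * ennreal (q\<^sup>2) + ennreal e)"
    by (intro mult_left_mono add_mono Iu Iv) auto
  also have "\<dots> = ennreal ((r + q + e)\<^sup>2)"
    using pos by (simp add: ennreal_mult[symmetric] ennreal_plus[symmetric] power2_eq_square
          del: ennreal_plus)
  finally show ?thesis .
qed

text \<open>Real bounds \<open>r\<close> and \<open>q\<close> avoid square roots of extended values.
  Near-optimal couplings stand in for minimisers, and the error then tends to 0.\<close>

lemma W2_sq_triangle:
  fixes \<mu> \<eta> \<nu> :: "'a::euclidean_space measure"
  assumes "W2_sq \<mu> \<eta> \<le> ennreal (r\<^sup>2)" "W2_sq \<eta> \<nu> \<le> ennreal (q\<^sup>2)" "r \<ge> 0" "q \<ge> 0"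
  shows "W2_sq \<mu> \<nu> \<le> ennreal ((r + q)\<^sup>2)"
proof -
  have approx: "W2_sq \<mu> \<nu> \<le> ennreal ((r + q + 3 * e)\<^sup>2)" if "e > 0" for e
  proof -
    \<comment> \<open>Of the error \<open>3 * e\<close>, two parts leave room for near-optimal plans
      and keep the radii positive; the third is the gluing error.\<close>
    have "W2_sq \<mu> \<eta> < ennreal ((r + e)\<^sup>2)" "W2_sq \<eta> \<nu> < ennreal ((q + e)\<^sup>2)"
      using that assms by (auto intro!: le_less_trans[OF assms(1)] le_less_trans[OF assms(2)]
          ennreal_lessI power_strict_mono zero_less_power)
    then obtain \<gamma>\<^sub>1 \<gamma>\<^sub>2 where "\<gamma>\<^sub>1 \<in> couplings \<mu> \<eta>" "\<gamma>\<^sub>2 \<in> couplings \<eta> \<nu>"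
      "transport_cost \<gamma>\<^sub>1 < ennreal ((r + e)\<^sup>2)" "transport_cost \<gamma>\<^sub>2 < ennreal ((q + e)\<^sup>2)"
      unfolding W2_sq_def INF_less_iff by blast
    then have "W2_sq \<mu> \<nu> \<le> ennreal ((r + e + (q + e) + e)\<^sup>2)"
      using that assms by (intro W2_sq_approximate_triangle) auto
    then show ?thesis by (simp add: algebra_simps)
  qed
  have "((\<lambda>e. ennreal ((r + q + 3 * e)\<^sup>2)) \<longlongrightarrow> ennreal ((r + q + 3 * 0)\<^sup>2)) (at_right 0)"
    by (intro tendsto_intros)
  moreover have "\<forall>\<^sub>F e in at_right 0. W2_sq \<mu> \<nu> \<le> ennreal ((r + q + 3 * e)\<^sup>2)"
    by (rule eventually_at_rightI[of 0 1]) (auto intro: approx)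
  ultimately have "W2_sq \<mu> \<nu> \<le> ennreal ((r + q + 3 * 0)\<^sup>2)"
    by (rule tendsto_lowerbound) simp
  then show ?thesis by simp
qed

section \<open>Constant-speed geodesics and finiteness of the cost\<close>

lemma mccann_dist_sq:
  fixes p :: "'a::euclidean_space \<times> 'a"
  shows "(norm (interp a p - interp b p))\<^sup>2 = (a - b)\<^sup>2 * (norm (fst p - snd p))\<^sup>2"
proof -
  have "interp a p - interp b p = (b - a) *\<^sub>R (fst p - snd p)"
    by (simp add: interp_def case_prod_beta algebra_simps)
  then show ?thesis by (simp add: power_mult_distrib power2_commute)
qed

lemma W2_sq_mccann_le:
  fixes \<pi> :: "('a::euclidean_space \<times> 'a) measure"
  assumes "\<pi> \<in> couplings \<mu> \<nu>"
  shows "W2_sq (mccann \<pi> a) (mccann \<pi> b) \<le> ennreal ((a - b)\<^sup>2) * transport_cost \<pi>"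
proof -
  note c = couplingsD[OF assms]
  note [measurable_cong] = c(2)
  have "W2_sq (mccann \<pi> a) (mccann \<pi> b) \<le>
      (\<integral>\<^sup>+p. ennreal ((norm (interp a p - interp b p))\<^sup>2) \<partial>\<pi>)"
    unfolding mccann_def by (rule W2_sq_le_of_maps) (auto intro: c)
  also have "\<dots> = ennreal ((a - b)\<^sup>2) * transport_cost \<pi>"
    unfolding transport_cost_def case_prod_beta mccann_dist_sq
    by (simp add: ennreal_mult nn_integral_cmult)
  finally show ?thesis .
qed

text \<open>Straight-line motion gives the upper bound. A shortcut between times \<open>a\<close>
  and \<open>b\<close> would, by the triangle inequality, bring the endpoints closer than the
  optimal distance \<open>d\<close>.\<close>

lemma W2_sq_mccann:
  fixes \<pi> :: "('a::euclidean_space \<times> 'a) measure"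
  assumes opt: "optimal_plan \<mu> \<nu> \<pi>" and d: "transport_cost \<pi> = ennreal (d\<^sup>2)" "d \<ge> 0"
    and ab: "a \<in> {0..1}" "b \<in> {0..1}"
  shows "W2_sq (mccann \<pi> a) (mccann \<pi> b) = ennreal ((a - b)\<^sup>2 * d\<^sup>2)"
proof -
  note \<pi> = optimal_planD[OF opt]
  have upper: "W2_sq (mccann \<pi> a) (mccann \<pi> b) \<le> ennreal (((b - a) * d)\<^sup>2)" for a b
    using W2_sq_mccann_le[OF \<pi>(1), of a b]
    by (simp add: d ennreal_mult[symmetric] power_mult_distrib power2_commute)
  have ordered: "W2_sq (mccann \<pi> a) (mccann \<pi> b) = ennreal ((a - b)\<^sup>2 * d\<^sup>2)"
    if "0 \<le> a" "a \<le> b" "b \<le> 1" for a b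
  proof -
    \<comment> \<open>\<open>w\<close> is the length of the middle piece; two triangle inequalities
      assemble the route through the times 0, \<open>a\<close>, \<open>b\<close>, 1.\<close>
    define w where "w = sqrt (enn2real (W2_sq (mccann \<pi> a) (mccann \<pi> b)))"
    have "W2_sq (mccann \<pi> a) (mccann \<pi> b) < top"
      using upper[of a b] by (simp add: le_less_trans)
    then have w: "W2_sq (mccann \<pi> a) (mccann \<pi> b) = ennreal (w\<^sup>2)" "w \<ge> 0"
      by (auto simp: w_def)
    have "W2_sq (mccann \<pi> 0) (mccann \<pi> b) \<le> ennreal (((a - 0) * d + w)\<^sup>2)"
      by (rule W2_sq_triangle[OF upper[of 0 a] eq_refl[OF w(1)]]) (use that d w in auto)
    then have "W2_sq (mccann \<pi> 0) (mccann \<pi> 1) \<le> ennreal (((a - 0) * d + w + (1 - b) * d)\<^sup>2)"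
      by (rule W2_sq_triangle[OF _ upper[of b 1]]) (use that d w in auto)
    then have "d\<^sup>2 \<le> (a * d + w + (1 - b) * d)\<^sup>2"
      using \<pi> d by (simp add: mccann_ends[OF \<pi>(1)])
    then have "d \<le> a * d + w + (1 - b) * d"
      by (rule power2_le_imp_le) (use that d w in auto)
    then have "(b - a) * d \<le> w" by (simp add: algebra_simps)
    then have "((b - a) * d)\<^sup>2 \<le> w\<^sup>2"
      by (rule power_mono) (use that d in auto)
    then have "ennreal (((b - a) * d)\<^sup>2) \<le> W2_sq (mccann \<pi> a) (mccann \<pi> b)"
      unfolding w by (rule ennreal_leI)
    with upper[of a b] show ?thesis
      by (simp add: antisym power_mult_distrib power2_commute)
  qed
  show ?thesis
    using ordered[of a b] ordered[of b a] ab
    by (cases "a \<le> b") (auto simp: W2_sq_commute power2_commute)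
qed

text \<open>Two positions at distinct times determine the displacement, so moments at these times
  control the cost. For a containing plan, the times are those at which it passes through \<mu> and
  \<nu>.\<close>

lemma transport_cost_finite:
  fixes \<pi> :: "('a::euclidean_space \<times> 'a) measure"
  assumes "sets \<pi> = sets borel" "a \<noteq> b"
    and fin: "finite_second_moment (mccann \<pi> a)" "finite_second_moment (mccann \<pi> b)"
  shows "transport_cost \<pi> < \<infinity>"
proof -
  note [measurable_cong] = assms(1)
  \<comment> \<open>The factor 2 comes from bounding the square of a sum, the denominator from
    rescaling the displacement over the time \<open>a - b\<close>.\<close>
  define k where "k = 2 / (a - b)\<^sup>2"
  have k: "k \<ge> 0" by (simp add: k_def)
  have int: "(\<integral>\<^sup>+p. ennreal ((norm (interp s p))\<^sup>2) \<partial>\<pi>) < \<infinity>"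
    if "finite_second_moment (mccann \<pi> s)" for s
    using that unfolding finite_second_moment_def mccann_def
    by (subst (asm) nn_integral_distr) auto
  have bound: "(norm (fst p - snd p))\<^sup>2 \<le> k * (norm (interp a p))\<^sup>2 + k * (norm (interp b p))\<^sup>2"
    for p :: "'a \<times> 'a"
  proof -
    have "(norm (interp a p - interp b p))\<^sup>2 \<le> (norm (interp a p) + norm (interp b p))\<^sup>2"
      by (intro power_mono norm_triangle_ineq4) auto
    also have "\<dots> \<le> 2 * (norm (interp a p))\<^sup>2 + 2 * (norm (interp b p))\<^sup>2"
      using sum_squares_ge_zero[of "norm (interp a p) - norm (interp b p)" 0]
      by (simp add: power2_eq_square algebra_simps)
    finally have "(a - b)\<^sup>2 * (norm (fst p - snd p))\<^sup>2 \<le> 2 * (norm (interp a p))\<^sup>2 + 2 * (norm (interp b p))\<^sup>2"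
      by (simp add: mccann_dist_sq)
    then show ?thesis
      using \<open>a \<noteq> b\<close> by (simp add: k_def field_simps)
  qed
  have "transport_cost \<pi> \<le> (\<integral>\<^sup>+p. ennreal k * ennreal ((norm (interp a p))\<^sup>2)
      + ennreal k * ennreal ((norm (interp b p))\<^sup>2) \<partial>\<pi>)"
    unfolding transport_cost_def case_prod_beta
    by (intro nn_integral_mono)
      (use bound k in \<open>simp add: ennreal_mult[symmetric] ennreal_plus[symmetric] ennreal_leI del: ennreal_plus\<close>)
  also have "\<dots> = ennreal k * (\<integral>\<^sup>+p. ennreal ((norm (interp a p))\<^sup>2) \<partial>\<pi>)
      + ennreal k * (\<integral>\<^sup>+p. ennreal ((norm (interp b p))\<^sup>2) \<partial>\<pi>)"
    by (simp add: nn_integral_add nn_integral_cmult)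
  also have "\<dots> < \<infinity>"
    using int[OF fin(1)] int[OF fin(2)] by (simp add: ennreal_mult_less_top)
  finally show ?thesis .
qed

lemma finite_cost_square:
  assumes "transport_cost \<pi> < \<infinity>"
  obtains d where "transport_cost \<pi> = ennreal (d\<^sup>2)" "d \<ge> 0"
  using that[of "sqrt (enn2real (transport_cost \<pi>))"] assms by simp

text \<open>Vanishing cost concentrates the plan on the diagonal. For distinct marginals this makes
  the speed \<open>d\<close> positive.\<close>

lemma zero_cost_marginals_eq:
  assumes "\<pi> \<in> couplings \<mu> \<nu>" "transport_cost \<pi> = 0"
  shows "\<mu> = \<nu>"
proof -
  note c = couplingsD[OF assms(1)]
  note [measurable_cong] = c(2)
  have "AE p in \<pi>. fst p = snd p"
    using assms(2) unfolding transport_cost_def case_prod_beta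
    by (subst (asm) nn_integral_0_iff_AE) auto
  then have "distr \<pi> borel fst = distr \<pi> borel snd"
    by (intro distr_cong_AE) auto
  then show ?thesis using c by simp
qed

section \<open>Objective values of feasible pairs\<close>

lemma objective_mccann:
  assumes opt: "optimal_plan \<mu> \<nu> \<pi>" and d: "transport_cost \<pi> = ennreal (d\<^sup>2)" "d \<ge> 0"
    and s: "s \<in> {0..1}"
  shows "objective (mccann \<pi> s) ((\<mu>, \<nu>), s) = ennreal (s * (1 - s) * d\<^sup>2)"
proof -
  note e = mccann_ends[OF optimal_planD(1)[OF opt]]
  have "W2_sq \<mu> (mccann \<pi> s) = ennreal (s\<^sup>2 * d\<^sup>2)"
    using W2_sq_mccann[OF opt d, of 0 s] s by (simp add: e)
  moreover have "W2_sq \<nu> (mccann \<pi> s) = ennreal ((1 - s)\<^sup>2 * d\<^sup>2)"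
    using W2_sq_mccann[OF opt d, of 1 s] s by (simp add: e)
  moreover have "(1 - s) * (s\<^sup>2 * d\<^sup>2) + s * ((1 - s)\<^sup>2 * d\<^sup>2) = s * (1 - s) * d\<^sup>2"
    by (simp add: power2_eq_square algebra_simps)
  ultimately show ?thesis
    using s by (simp add: objective_def ennreal_mult[symmetric] ennreal_plus[symmetric] del: ennreal_plus)
qed

text \<open>For \<open>u \<le> s \<le> v\<close> the deficit is
  \<open>u * (1 - s) + (s - u) * (1 - v)\<close>, a sum of nonnegative terms. If it vanishes and
  \<open>u < s < v\<close>, the second term gives \<open>v = 1\<close> and the first then
  \<open>u = 0\<close>. Strictness matters: for \<open>u = s = 0\<close> both products vanish
  whatever \<open>v\<close> is.\<close>

lemma product_le_of_between:
  fixes s u v :: real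
  assumes "0 \<le> u" "u \<le> 1" "0 \<le> v" "v \<le> 1" and between: "\<bar>u - s\<bar> + \<bar>v - s\<bar> = \<bar>u - v\<bar>"
  shows "\<bar>u - s\<bar> * \<bar>v - s\<bar> \<le> s * (1 - s)"
    and "\<bar>u - s\<bar> * \<bar>v - s\<bar> = s * (1 - s) \<Longrightarrow> u \<noteq> s \<Longrightarrow> v \<noteq> s \<Longrightarrow>
      (u = 0 \<and> v = 1) \<or> (u = 1 \<and> v = 0)"
proof -
  have *: "(s - u) * (v - s) \<le> s * (1 - s) \<and>
      ((s - u) * (v - s) = s * (1 - s) \<longrightarrow> u \<noteq> s \<longrightarrow> v \<noteq> s \<longrightarrow> u = 0 \<and> v = 1)"
    if "0 \<le> u" "u \<le> s" "s \<le> v" "v \<le> 1" for u v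
  proof -
    have eq: "s * (1 - s) - (s - u) * (v - s) = u * (1 - s) + (s - u) * (1 - v)"
      by (simp add: algebra_simps)
    have "u * (1 - s) \<ge> 0" "(s - u) * (1 - v) \<ge> 0"
      using that by auto
    then show ?thesis
      using eq that by (smt (verit) mult_eq_0_iff)
  qed
  consider "u \<le> s" "s \<le> v" | "v \<le> s" "s \<le> u"
    using between by linarith
  note cases = this
  show "\<bar>u - s\<bar> * \<bar>v - s\<bar> \<le> s * (1 - s)"
    using cases *[of u v] *[of v u] assms by cases (auto simp: abs_if algebra_simps)
  show "(u = 0 \<and> v = 1) \<or> (u = 1 \<and> v = 0)"
    if "\<bar>u - s\<bar> * \<bar>v - s\<bar> = s * (1 - s)" "u \<noteq> s" "v \<noteq> s"
    using cases
  proof cases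
    case 1
    then show ?thesis using *[of u v] that assms by auto
  next
    case 2
    then show ?thesis using *[of v u] that assms by (auto simp: mult.commute)
  qed
qed

lemma objective_containing:
  fixes \<mu> \<nu> :: "'a::euclidean_space measure"
  assumes opt: "optimal_plan \<mu> \<nu> \<pi>" and d: "transport_cost \<pi> = ennreal (d\<^sup>2)" "d \<ge> 0"
    and mom: "finite_second_moment \<mu>" "finite_second_moment \<nu>" and ne: "\<mu> \<noteq> \<nu>"
    and t: "t \<in> {0..1}"
    and opt': "optimal_plan \<mu>' \<nu>' \<pi>'" and cont: "contains_mccann \<pi>' \<pi>"
    and s: "s \<in> {0..1}" and st: "mccann \<pi>' s = mccann \<pi> t"
  shows "ennreal (t * (1 - t) * d\<^sup>2) \<le> objective (mccann \<pi> t) ((\<mu>', \<nu>'), s)"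
    and "objective (mccann \<pi> t) ((\<mu>', \<nu>'), s) = ennreal (t * (1 - t) * d\<^sup>2) \<Longrightarrow> 0 < t \<Longrightarrow> t < 1 \<Longrightarrow>
      (\<mu>', \<nu>') = (\<mu>, \<nu>) \<or> (\<mu>', \<nu>') = (\<nu>, \<mu>)"
proof -
  note \<pi> = optimal_planD[OF opt] and \<pi>' = optimal_planD[OF opt']
  note ends = mccann_ends[OF \<pi>(1)] and ends' = mccann_ends[OF \<pi>'(1)]
  have reach: "\<exists>s\<in>{0..1}. mccann \<pi>' s = mccann \<pi> x" if "x \<in> {0..1}" for x
    using cont that unfolding contains_mccann_def by (meson atLeastAtMost_iff order_trans)
  obtain u where u: "u \<in> {0..1}" "mccann \<pi>' u = \<mu>"
    using reach[of 0] ends by auto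
  obtain v where v: "v \<in> {0..1}" "mccann \<pi>' v = \<nu>"
    using reach[of 1] ends by auto
  have "u \<noteq> v" using u v ne by auto
  then have "transport_cost \<pi>' < \<infinity>"
    using u v mom couplingsD(2)[OF \<pi>'(1)] by (intro transport_cost_finite[of _ u v]) auto
  then obtain d' where d': "transport_cost \<pi>' = ennreal (d'\<^sup>2)" "d' \<ge> 0"
    by (rule finite_cost_square)
  \<comment> \<open>Measures common to both interpolations have the same \<open>W2_sq\<close>
    distance computed along either one, so time gaps are compared without any assumption on how the
    times correspond.\<close>
  have speed: "\<bar>x - y\<bar> * d' = \<bar>x' - y'\<bar> * d"
    if "x \<in> {0..1}" "y \<in> {0..1}" "x' \<in> {0..1}" "y' \<in> {0..1}"
      "mccann \<pi>' x = mccann \<pi> x'" "mccann \<pi>' y = mccann \<pi> y'" for x y x' y'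
  proof -
    have "ennreal ((x - y)\<^sup>2 * d'\<^sup>2) = ennreal ((x' - y')\<^sup>2 * d\<^sup>2)"
      using W2_sq_mccann[OF opt' d' that(1,2)] W2_sq_mccann[OF opt d that(3,4)] that by simp
    then have "(\<bar>x - y\<bar> * d')\<^sup>2 = (\<bar>x' - y'\<bar> * d)\<^sup>2"
      by (simp add: power_mult_distrib)
    then show ?thesis
      by (rule power2_eq_imp_eq) (use d(2) d'(2) in simp_all)
  qed
  have "\<bar>u - v\<bar> * d' = \<bar>0 - 1\<bar> * d"
    by (rule speed) (use u v ends in simp_all)
  then have uv: "\<bar>u - v\<bar> * d' = d" by simp
  have "\<bar>u - s\<bar> * d' = \<bar>0 - t\<bar> * d"
    by (rule speed) (use u s t st ends in simp_all)
  then have us: "\<bar>u - s\<bar> * d' = t * d" using t by simp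
  have "\<bar>v - s\<bar> * d' = \<bar>1 - t\<bar> * d"
    by (rule speed) (use v s t st ends in simp_all)
  then have vs: "\<bar>v - s\<bar> * d' = (1 - t) * d" using t by simp
  have "d \<noteq> 0"
    using zero_cost_marginals_eq[OF \<pi>(1)] d ne by auto
  with uv d d' have pos: "d > 0" "d' > 0" by (auto simp: less_le)
  \<comment> \<open>Since \<open>t * d\<close> and \<open>(1 - t) * d\<close> add up to
    \<open>d\<close>, the triangle inequality between the times is an equality, which places
    \<open>s\<close> between \<open>u\<close> and \<open>v\<close>.\<close>
  have "(\<bar>u - s\<bar> + \<bar>v - s\<bar>) * d' = \<bar>u - v\<bar> * d'"
    using uv us vs by (simp add: algebra_simps)
  then have between: "\<bar>u - s\<bar> + \<bar>v - s\<bar> = \<bar>u - v\<bar>"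
    using pos by simp
  have prod: "t * (1 - t) * d\<^sup>2 = \<bar>u - s\<bar> * \<bar>v - s\<bar> * d'\<^sup>2"
  proof -
    have "t * (1 - t) * d\<^sup>2 = (t * d) * ((1 - t) * d)"
      by (simp add: power2_eq_square)
    also have "\<dots> = \<bar>u - s\<bar> * \<bar>v - s\<bar> * d'\<^sup>2"
      unfolding us[symmetric] vs[symmetric] by (simp add: power2_eq_square)
    finally show ?thesis .
  qed
  have obj: "objective (mccann \<pi> t) ((\<mu>', \<nu>'), s) = ennreal (s * (1 - s) * d'\<^sup>2)"
    using objective_mccann[OF opt' d' s] st by simp
  have uv01: "0 \<le> u" "u \<le> 1" "0 \<le> v" "v \<le> 1" using u v by auto
  note le = product_le_of_between[OF uv01 between]
  show "ennreal (t * (1 - t) * d\<^sup>2) \<le> objective (mccann \<pi> t) ((\<mu>', \<nu>'), s)"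
    unfolding obj prod by (intro ennreal_leI mult_right_mono le) auto
  assume eq: "objective (mccann \<pi> t) ((\<mu>', \<nu>'), s) = ennreal (t * (1 - t) * d\<^sup>2)"
    and t': "0 < t" "t < 1"
  have "s * (1 - s) * d'\<^sup>2 = \<bar>u - s\<bar> * \<bar>v - s\<bar> * d'\<^sup>2"
    using eq s unfolding obj prod by simp
  then have "\<bar>u - s\<bar> * \<bar>v - s\<bar> = s * (1 - s)"
    using pos by simp
  \<comment> \<open>Strict inequalities for \<open>t\<close> enter here: the barycenter is at
    positive distance from both \<mu> and \<nu>.\<close>
  moreover have "u \<noteq> s" "v \<noteq> s"
    using us vs pos t' by auto
  ultimately have "(u = 0 \<and> v = 1) \<or> (u = 1 \<and> v = 0)"
    by (rule le(2))
  then show "(\<mu>', \<nu>') = (\<mu>, \<nu>) \<or> (\<mu>', \<nu>') = (\<nu>, \<mu>)"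
    using u v ends' by auto
qed

section \<open>Feasibility and the set of minimisers\<close>

text \<open>The plan witnessing feasibility also witnesses containment, and its marginals are Borel
  probability measures as pushforwards of one.\<close>

lemma feasible_iff:
  "((\<mu>', \<nu>'), s) \<in> feasible \<pi> t \<longleftrightarrow> s \<in> {0..1} \<and>
    (\<exists>\<pi>'. optimal_plan \<mu>' \<nu>' \<pi>' \<and> contains_mccann \<pi>' \<pi> \<and> mccann \<pi>' s = mccann \<pi> t)"
proof -
  have "\<mu>' \<in> borel_probs \<and> \<nu>' \<in> borel_probs" if "optimal_plan \<mu>' \<nu>' \<pi>'" for \<pi>'
  proof -
    note c = couplingsD[OF optimal_planD(1)[OF that]]
    show ?thesis
      using distr_borel_probs[OF c(1), of fst] distr_borel_probs[OF c(1), of snd] c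
      by (simp add: measurable_cong_sets[OF c(2) refl])
  qed
  then show ?thesis
    unfolding feasible_def containing_pairs_def associated_plans_def by auto
qed

theorem corollary1:
  fixes \<mu> \<nu> :: "(real ^ 'd) measure" and \<pi> :: "((real ^ 'd) \<times> (real ^ 'd)) measure" and t :: real
  assumes "\<mu> \<in> borel_probs" and "\<nu> \<in> borel_probs"
    and "finite_second_moment \<mu>" and "finite_second_moment \<nu>"
    and "\<mu> \<noteq> \<nu>"
    and "optimal_plan \<mu> \<nu> \<pi>"
    and "0 \<le> t" and "t \<le> 1"
  shows "is_arg_min (objective (mccann \<pi> t)) (\<lambda>q. q \<in> feasible \<pi> t) ((\<mu>, \<nu>), t) \<and>
    (0 < t \<and> t < 1 \<longrightarrow> argmin_pairs \<pi> t = {(\<mu>, \<nu>), (\<nu>, \<mu>)})"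
proof -
  note opt = \<open>optimal_plan \<mu> \<nu> \<pi>\<close>
  note \<pi> = optimal_planD[OF opt]
  have t: "t \<in> {0..1}" using assms by simp
  have "transport_cost \<pi> < \<infinity>"
    using couplingsD(2)[OF \<pi>(1)] mccann_ends[OF \<pi>(1)] assms
    by (intro transport_cost_finite[of _ 0 1]) auto
  then obtain d where d: "transport_cost \<pi> = ennreal (d\<^sup>2)" "d \<ge> 0"
    by (rule finite_cost_square)
  let ?obj = "objective (mccann \<pi> t)" and ?min = "ennreal (t * (1 - t) * d\<^sup>2)"
  have lower: "?min \<le> ?obj q" if "q \<in> feasible \<pi> t" for q
    using that objective_containing(1)[OF opt d assms(3-5) t]
    by (cases q) (auto simp: feasible_iff)
  have val: "?obj ((\<mu>, \<nu>), t) = ?min"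
    by (rule objective_mccann[OF opt d t])
  have "contains_mccann \<pi> \<pi>"
    unfolding contains_mccann_def by (rule exI[of _ 0], rule exI[of _ 1]) auto
  then have feas: "((\<mu>, \<nu>), t) \<in> feasible \<pi> t"
    unfolding feasible_iff using opt t by auto
  have swap: "mccann (swap_plan \<pi>) (1 - s) = mccann \<pi> s" for s
    using mccann_swap_plan[OF couplingsD(2)[OF \<pi>(1)], of "1 - s"] by simp
  \<comment> \<open>The reversed plan runs through the same measures, visiting at time
    \<open>1 - s\<close> what \<open>\<pi>\<close> visits at \<open>s\<close>.\<close>
  have "contains_mccann (swap_plan \<pi>) \<pi>"
    unfolding contains_mccann_def
    by (rule exI[of _ 0], rule exI[of _ 1]) (use swap in \<open>fastforce intro: bexI[of _ "1 - x" for x]\<close>)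
  then have feas': "((\<nu>, \<mu>), 1 - t) \<in> feasible \<pi> t"
    unfolding feasible_iff using optimal_plan_swap[OF opt] t swap by auto
  have val': "?obj ((\<nu>, \<mu>), 1 - t) = ?min"
    using val by (simp add: objective_def add.commute)
  \<comment> \<open>The lower bound is attained at \<open>((\<mu>, \<nu>), t)\<close>, so minimisers
    are exactly the feasible points with value \<open>?min\<close>; the equality case then
    identifies their pairs.\<close>
  have argmin: "is_arg_min ?obj (\<lambda>q. q \<in> feasible \<pi> t) q \<longleftrightarrow> q \<in> feasible \<pi> t \<and> ?obj q = ?min" for q
    using lower feas val unfolding is_arg_min_linorder by (metis antisym)
  have "argmin_pairs \<pi> t = {(\<mu>, \<nu>), (\<nu>, \<mu>)}" if "0 < t" "t < 1"
  proof (intro equalityI subsetI)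
    fix p assume "p \<in> argmin_pairs \<pi> t"
    then show "p \<in> {(\<mu>, \<nu>), (\<nu>, \<mu>)}"
      using objective_containing(2)[OF opt d assms(3-5) t] that
      by (cases p) (fastforce simp: argmin_pairs_def argmin feasible_iff)
  next
    fix p assume "p \<in> {(\<mu>, \<nu>), (\<nu>, \<mu>)}"
    then show "p \<in> argmin_pairs \<pi> t"
      using feas feas' val val' by (auto simp: argmin_pairs_def argmin)
  qed
  then show ?thesis
    using feas val by (simp add: argmin)
qed

end
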